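(* Let $X$ and $Y$ be Banach spaces, and let $A\in\mathcal L(X,Y)$. Suppose that $AX$ is closed in $Y$ and that $\dim(\ker A)<\infty$. Then for any $x\in X$ and any sequence $\{x_k\}\subset X$, we have $$\big[x_k\rightharpoonup x,\ Ax_k\to Ax\big]\Longrightarrow x_k\to x\quad\text{as }k\to\infty.$$
   Context: $\mathcal L(X,Y)$ is the space of bounded linear operators from $X$ to $Y$; $\rightharpoonup$ denotes weak convergence and $\to$ norm convergence. *)

theory Defs
  imports "HOL-Analysis.Analysis"
begin

definition weakly_converges :: "(nat \<Rightarrow> 'a::real_normed_vector) \<Rightarrow> 'a \<Rightarrow> bool"
  where "weakly_converges X x \<longleftrightarrow>
    (\<forall>f :: 'a \<Rightarrow>\<^sub>L real. (\<lambda>k. blinfun_apply f (X k)) \<longlonglongrightarrow> blinfun_apply f x)"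

(* The library's dim returns 0 on infinite-dimensional subspaces, so a bound
   on it would not express finite-dimensionality. *)
definition finite_dimensional :: "'a::real_vector set \<Rightarrow> bool"
  where "finite_dimensional S \<longleftrightarrow> (\<exists>B. finite B \<and> span B = S)"

definition blinfun_kernel :: "('a::real_normed_vector \<Rightarrow>\<^sub>L 'b::real_normed_vector) \<Rightarrow> 'a set"
  where "blinfun_kernel A = {v. blinfun_apply A v = 0}"

end

theory Submission
  imports Defs
begin

text \<open>
  The operator \<open>A\<close> maps the Banach space \<open>X\<close> onto the Banach space \<open>range A\<close>, so by the open
  mapping theorem there is a constant \<open>C\<close> such that every \<open>y\<close> in \<open>range A\<close> has a preimage of norm
  at most \<open>C * norm y\<close> (\<open>bounded_preimages\<close>). Applied to \<open>y = A (x\<^sub>k - x)\<close>, which tends to \<open>0\<close>,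
  this splits \<open>x\<^sub>k - x = u\<^sub>k + z\<^sub>k\<close> with \<open>u\<^sub>k\<close> tending to \<open>0\<close> in norm and \<open>z\<^sub>k\<close> in the kernel.
  Then \<open>z\<^sub>k\<close> tends weakly to \<open>0\<close> inside a finite-dimensional subspace, hence in norm
  (\<open>weakly_null_in_finite_span\<close>).

  The last step requires enough functionals on the whole of \<open>X\<close>, that is, the Hahn-Banach theorem
  (\<open>separating_functional\<close>). It is obtained from Zorn's lemma by showing that a minimal
  sublinear functional is linear, which avoids extending functionals from subspaces. The open
  mapping theorem is obtained in the usual way from the Baire category theorem and successive
  approximation.
\<close>

section \<open>Sublinear functionals and the Hahn-Banach theorem\<close>

text \<open>Real-valued functionals that are subadditive and positively homogeneous.\<close>

definition sublinear :: "('a::real_vector \<Rightarrow> real) \<Rightarrow> bool"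
  where "sublinear p \<longleftrightarrow>
    (\<forall>x y. p (x + y) \<le> p x + p y) \<and> (\<forall>c x. 0 \<le> c \<longrightarrow> p (c *\<^sub>R x) = c * p x)"

lemma sublinear_add: "sublinear p \<Longrightarrow> p (x + y) \<le> p x + p y"
  by (simp add: sublinear_def)

lemma sublinear_scaleR: "sublinear p \<Longrightarrow> 0 \<le> c \<Longrightarrow> p (c *\<^sub>R x) = c * p x"
  by (simp add: sublinear_def)

lemma sublinear_zero: "sublinear p \<Longrightarrow> p 0 = 0"
  using sublinear_scaleR[of p 0 0] by simp

lemma sublinear_ge_minus: "sublinear p \<Longrightarrow> - p (- x) \<le> p x"
  using sublinear_add[of p x "- x"] by (simp add: sublinear_zero)

text \<open>For positive scalars one inequality suffices, since \<open>c\<close> may be replaced by \<open>1 / c\<close>.\<close>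

lemma sublinearI:
  assumes add: "\<And>x y. p (x + y) \<le> p x + p y"
    and scale: "\<And>c x. 0 < c \<Longrightarrow> p (c *\<^sub>R x) \<le> c * p x"
  shows "sublinear p"
  unfolding sublinear_def
proof (intro conjI allI impI)
  show "p (x + y) \<le> p x + p y" for x y by (rule add)
  fix c :: real and x
  assume "0 \<le> c"
  show "p (c *\<^sub>R x) = c * p x"
  proof (cases "c = 0")
    case True
    then show ?thesis
      using scale[of 2 0] scale[of "1/2" 0] by simp
  next
    case False
    with \<open>0 \<le> c\<close> have c: "0 < c" by simp
    have "p ((1 / c) *\<^sub>R (c *\<^sub>R x)) \<le> (1 / c) * p (c *\<^sub>R x)"
      by (rule scale) (use c in simp)
    with c have "c * p x \<le> p (c *\<^sub>R x)"
      by (simp add: field_simps)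
    with scale[OF c, of x] show ?thesis by simp
  qed
qed

text \<open>
  Pushing \<open>p\<close> down along the direction \<open>y\<close> by \<open>q x = inf\<^sub>t (p (x + t y) - t p y)\<close> over \<open>t \<ge> 0\<close>. The value
  \<open>- p y\<close> at \<open>- y\<close> is what a functional linear along \<open>y\<close> with value \<open>p y\<close> at \<open>y\<close> must have.
\<close>

lemma sublinear_push_down:
  fixes p :: "'a::real_vector \<Rightarrow> real"
  assumes p: "sublinear p"
  obtains q where "sublinear q" "q \<le> p" "q (- y) \<le> - p y"
proof -
  define h where "h x t = p (x + t *\<^sub>R y) - t * p y" for x t
  define q where "q x = (INF t\<in>{0..}. h x t)" for x
  have lower: "- p (- x) \<le> h x t" if "0 \<le> t" for x t
    using sublinear_add[OF p, of "x + t *\<^sub>R y" "- x"] sublinear_scaleR[OF p that, of y]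
    by (simp add: h_def)
  have q_le: "q x \<le> h x t" if "0 \<le> t" for x t
    unfolding q_def
    by (rule cINF_lower) (use that in \<open>auto intro!: bdd_belowI2 lower\<close>)
  have q_ge: "b \<le> q x" if "\<And>t. 0 \<le> t \<Longrightarrow> b \<le> h x t" for b x
    unfolding q_def by (rule cINF_greatest) (use that in auto)
  have h_add: "h (x + x') (t + t') \<le> h x t + h x' t'" for x x' t t'
    using sublinear_add[OF p, of "x + t *\<^sub>R y" "x' + t' *\<^sub>R y"]
    by (simp add: h_def algebra_simps)
  have h_scale: "h (c *\<^sub>R x) (c * t) = c * h x t" if "0 < c" for c x t
    using sublinear_scaleR[OF p, of c "x + t *\<^sub>R y"] that
    by (simp add: h_def algebra_simps)
  have "sublinear q"
  proof (rule sublinearI)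
    fix x x'
    have *: "q (x + x') - h x t \<le> q x'" if "0 \<le> t" for t
    proof (rule q_ge)
      fix t' :: real
      assume "0 \<le> t'"
      with that show "q (x + x') - h x t \<le> h x' t'"
        using q_le[of "t + t'" "x + x'"] h_add[of x x' t t'] by simp
    qed
    have "q (x + x') - q x' \<le> q x"
      by (rule q_ge) (use * in force)
    then show "q (x + x') \<le> q x + q x'" by simp
  next
    fix c :: real and x
    assume c: "0 < c"
    have "q (c *\<^sub>R x) / c \<le> q x"
    proof (rule q_ge)
      fix t :: real
      assume "0 \<le> t"
      with c show "q (c *\<^sub>R x) / c \<le> h x t"
        using q_le[of "c * t" "c *\<^sub>R x"] h_scale[OF c, of x t] by (simp add: field_simps)
    qed
    with c show "q (c *\<^sub>R x) \<le> c * q x" by (simp add: field_simps)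
  qed
  moreover have "q \<le> p"
    using q_le[of 0] by (auto simp: le_fun_def h_def)
  moreover have "q (- y) \<le> - p y"
    using q_le[of 1 "- y"] by (simp add: h_def sublinear_zero[OF p])
  ultimately show thesis by (rule that)
qed

text \<open>Zorn's lemma applies because the pointwise infimum of a chain is again sublinear.\<close>

lemma minimal_sublinear_exists:
  fixes p :: "'a::real_vector \<Rightarrow> real"
  assumes p: "sublinear p"
  obtains f where "sublinear f" "f \<le> p" "\<And>q. sublinear q \<Longrightarrow> q \<le> f \<Longrightarrow> q = f"
proof -
  define S where "S = {q. sublinear q \<and> q \<le> p}"
  let ?R = "relation_of (\<lambda>a b. b \<le> a) S"
  have "\<exists>f\<in>S. \<forall>q\<in>S. q \<le> f \<longrightarrow> q = f"
  proof (rule predicate_Zorn)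
    show "partial_order_on S ?R"
      by (rule partial_order_on_relation_ofI) auto
    fix C
    assume C: "C \<in> Chains ?R"
    show "\<exists>u\<in>S. \<forall>q\<in>C. u \<le> q"
    proof (cases "C = {}")
      case True
      then show ?thesis using p by (auto simp: S_def)
    next
      case False
      from C have CS: "q \<in> S" if "q \<in> C" for q
        using that by (auto simp: Chains_def relation_of_def)
      have total: "q \<le> q' \<or> q' \<le> q" if "q \<in> C" "q' \<in> C" for q q'
        using C that by (auto simp: Chains_def relation_of_def)
      define u where "u x = (INF q\<in>C. q x)" for x
      have bdd: "- p (- x) \<le> q x" if "q \<in> C" for q x
      proof -
        from CS[OF that] have "sublinear q" "q (- x) \<le> p (- x)"
          by (auto simp: S_def le_fun_def)
        with sublinear_ge_minus[of q x] show ?thesis by simp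
      qed
      have u_le: "u x \<le> q x" if "q \<in> C" for q x
        unfolding u_def
        by (rule cINF_lower) (use that in \<open>auto intro!: bdd_belowI2 bdd\<close>)
      have u_ge: "b \<le> u x" if "\<And>q. q \<in> C \<Longrightarrow> b \<le> q x" for b x
        unfolding u_def by (rule cINF_greatest) (use that False in auto)
      have "sublinear u"
      proof (rule sublinearI)
        fix x y
        have **: "u (x + y) \<le> q x + q' y" if q: "q \<in> C" "q' \<in> C" for q q'
        proof -
          \<comment> \<open>Both values are bounded below by those of the smaller of the two functionals.\<close>
          obtain r where r: "r \<in> C" "r \<le> q" "r \<le> q'"
            using total[OF q] q by auto
          have "u (x + y) \<le> r (x + y)" by (rule u_le[OF r(1)])
          also have "\<dots> \<le> r x + r y"
            using CS[OF r(1)] by (auto simp: S_def intro: sublinear_add)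
          also have "\<dots> \<le> q x + q' y"
            using r by (intro add_mono) (auto simp: le_fun_def)
          finally show ?thesis .
        qed
        have *: "u (x + y) - q x \<le> u y" if "q \<in> C" for q
          by (rule u_ge) (use **[OF that] in force)
        have "u (x + y) - u y \<le> u x"
          by (rule u_ge) (use * in force)
        then show "u (x + y) \<le> u x + u y" by simp
      next
        fix c :: real and x
        assume c: "0 < c"
        have "u (c *\<^sub>R x) / c \<le> u x"
        proof (rule u_ge)
          fix q
          assume q: "q \<in> C"
          then have "q (c *\<^sub>R x) = c * q x"
            using CS[OF q] c by (auto simp: S_def intro: sublinear_scaleR)
          with c u_le[OF q, of "c *\<^sub>R x"] show "u (c *\<^sub>R x) / c \<le> q x"
            by (simp add: field_simps)
        qed
        with c show "u (c *\<^sub>R x) \<le> c * u x" by (simp add: field_simps)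
      qed
      moreover have "u \<le> p"
        using False u_le CS by (fastforce simp: S_def le_fun_def intro: order_trans)
      ultimately show ?thesis
        using u_le by (auto simp: S_def le_fun_def)
    qed
  qed
  then obtain f where f: "f \<in> S" and min: "\<And>q. q \<in> S \<Longrightarrow> q \<le> f \<Longrightarrow> q = f"
    by blast
  show thesis
  proof (rule that)
    show "sublinear f" "f \<le> p" using f by (auto simp: S_def)
    show "q = f" if "sublinear q" "q \<le> f" for q
      using min[of q] that f by (auto simp: S_def intro: order_trans)
  qed
qed

lemma minimal_sublinear_is_linear:
  fixes f :: "'a::real_vector \<Rightarrow> real"
  assumes f: "sublinear f" and min: "\<And>q. sublinear q \<Longrightarrow> q \<le> f \<Longrightarrow> q = f"
  shows "linear f"
proof -
  \<comment> \<open>By minimality, pushing \<open>f\<close> down along \<open>y\<close> returns \<open>f\<close>.\<close>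
  have "f (- y) \<le> - f y" for y
    using sublinear_push_down[OF f, of y] min by metis
  then have minus: "f (- y) = - f y" for y
    using sublinear_ge_minus[OF f, of "- y"] by (simp add: order_antisym)
  show ?thesis
  proof (rule linearI)
    fix x y
    have "f x + f y \<le> f (x + y)"
      using sublinear_add[OF f, of "- x" "- y"] minus[of "x + y"] minus[of x] minus[of y]
      by simp
    with sublinear_add[OF f, of x y] show "f (x + y) = f x + f y" by simp
  next
    fix c :: real and x
    show "f (c *\<^sub>R x) = c *\<^sub>R f x"
    proof (cases "0 \<le> c")
      case True
      then show ?thesis by (simp add: sublinear_scaleR[OF f])
    next
      case False
      then show ?thesis
        using sublinear_scaleR[OF f, of "- c" x] minus[of "c *\<^sub>R x"] by simp
    qed
  qed
qed

text \<open>The form of the Hahn-Banach theorem used below: nonzero vectors are detected by functionals.\<close>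

lemma separating_functional:
  fixes w :: "'a::real_normed_vector"
  assumes "w \<noteq> 0"
  obtains g :: "'a \<Rightarrow>\<^sub>L real" where "blinfun_apply g w = 1"
proof -
  have "sublinear (norm :: 'a \<Rightarrow> real)"
    by (simp add: sublinear_def norm_triangle_ineq)
  \<comment> \<open>Pushing the norm down along \<open>w\<close> first forces the value \<open>norm w\<close> at \<open>w\<close>.\<close>
  then obtain p :: "'a \<Rightarrow> real" where p: "sublinear p" "p \<le> norm" "p (- w) \<le> - norm w"
    by (rule sublinear_push_down)
  obtain f where f: "sublinear f" "f \<le> p" "\<And>q. sublinear q \<Longrightarrow> q \<le> f \<Longrightarrow> q = f"
    using minimal_sublinear_exists[OF p(1)] by metis
  interpret linear f
    by (rule minimal_sublinear_is_linear) (use f in auto)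
  have le: "f x \<le> norm x" for x
    using f(2) p(2) by (meson le_fun_def order_trans)
  have abs_le: "\<bar>f x\<bar> \<le> norm x" for x
    using le[of x] le[of "- x"] by (simp add: neg)
  have "bounded_linear f"
    by unfold_locales (use abs_le in \<open>auto intro!: exI[of _ 1]\<close>)
  have "f (- w) \<le> - norm w"
    using f(2) p(3) by (meson le_fun_def order_trans)
  then have "0 < f w"
    using assms by (simp add: neg) (meson less_le_trans zero_less_norm_iff)
  have "bounded_linear (\<lambda>x. f x / f w)"
    by (rule bounded_linear_compose[OF bounded_linear_divide \<open>bounded_linear f\<close>])
  with \<open>0 < f w\<close> have "blinfun_apply (Blinfun (\<lambda>x. f x / f w)) w = 1"
    by (simp add: bounded_linear_Blinfun_apply)
  then show thesis by (rule that)
qed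

section \<open>Weak convergence in finite-dimensional subspaces\<close>

text \<open>
  A functional \<open>g\<close> with \<open>g b = 1\<close> lets one spanning vector \<open>b\<close> be split off: the component
  \<open>g (z k) b\<close> tends to \<open>0\<close>, and what remains is weakly null and lies in the span of the projections
  \<open>v - g v b\<close> of the other vectors.
\<close>

lemma weakly_null_in_finite_span:
  fixes z :: "nat \<Rightarrow> 'a::real_normed_vector"
  assumes "finite B" and "\<And>k. z k \<in> span B" and "weakly_converges z 0"
  shows "z \<longlonglongrightarrow> 0"
  using assms
proof (induction "card B" arbitrary: B z rule: less_induct)
  case less
  show ?case
  proof (cases "B \<subseteq> {0}")
    case True
    then have "z k = 0" for k
      using less.prems(2)[of k] span_mono[OF True] by auto
    then show ?thesis by (simp add: tendsto_eventually)
  next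
    case False
    then obtain b where "b \<in> B" "b \<noteq> 0" by blast
    define B' where "B' = B - {b}"
    have B: "B = insert b B'" "finite B'" "card B' < card B"
      using \<open>b \<in> B\<close> \<open>finite B\<close> card_Diff1_less[of B b] by (auto simp: B'_def)
    from \<open>b \<noteq> 0\<close> obtain g :: "'a \<Rightarrow>\<^sub>L real" where g: "blinfun_apply g b = 1"
      by (rule separating_functional)
    define P where "P v = v - blinfun_apply g v *\<^sub>R b" for v
    have "linear P"
      by (rule linearI) (auto simp: P_def blinfun.add_right blinfun.scaleR_right algebra_simps)
    have gz: "(\<lambda>k. blinfun_apply g (z k)) \<longlonglongrightarrow> 0"
      using less.prems(3) by (simp add: weakly_converges_def)
    have "P (z k) \<in> span (P ` B')" for k
    proof -
      have "P (z k) \<in> P ` span B"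
        using less.prems(2) by blast
      also have "P ` span B = span (P ` B)"
        using linear_span_image[OF \<open>linear P\<close>, of B] by simp
      also have "P ` B = insert 0 (P ` B')"
        by (simp add: B(1) P_def g)
      finally show ?thesis by simp
    qed
    moreover have "weakly_converges (\<lambda>k. P (z k)) 0"
      unfolding weakly_converges_def
    proof
      fix f :: "'a \<Rightarrow>\<^sub>L real"
      have "(\<lambda>k. blinfun_apply f (z k)) \<longlonglongrightarrow> 0"
        using less.prems(3) by (simp add: weakly_converges_def)
      then have "(\<lambda>k. blinfun_apply f (z k) - blinfun_apply g (z k) * blinfun_apply f b)
          \<longlonglongrightarrow> 0 - 0 * blinfun_apply f b"
        by (intro tendsto_intros gz)
      then show "(\<lambda>k. blinfun_apply f (P (z k))) \<longlonglongrightarrow> blinfun_apply f 0"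
        by (simp add: P_def blinfun.diff_right blinfun.scaleR_right)
    qed
    ultimately have Pz: "(\<lambda>k. P (z k)) \<longlonglongrightarrow> 0"
      using B(2,3) card_image_le[OF B(2), of P]
      by (intro less.hyps[of "P ` B'"]) auto
    have "(\<lambda>k. P (z k) + blinfun_apply g (z k) *\<^sub>R b) \<longlonglongrightarrow> 0 + 0 *\<^sub>R b"
      by (intro tendsto_intros Pz gz)
    then show ?thesis by (simp add: P_def)
  qed
qed

section \<open>Open mapping theorem\<close>

text \<open>
  By the Baire category theorem the closure of some \<open>A ` cball 0 n\<close> has interior points relative
  to \<open>range A\<close>; differences of elements of \<open>A ` cball 0 n\<close> then approximate every point of a
  neighbourhood of \<open>0\<close> in \<open>range A\<close>.
\<close>

lemma approximate_preimages_near_zero: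
  fixes A :: "'a::real_normed_vector \<Rightarrow>\<^sub>L 'b::banach"
  assumes closed: "closed (range (blinfun_apply A))"
  obtains e M where "0 < e" "0 \<le> M"
    "\<And>y d. y \<in> range (blinfun_apply A) \<Longrightarrow> norm y < e \<Longrightarrow> 0 < d \<Longrightarrow>
      \<exists>u. norm u \<le> M \<and> norm (blinfun_apply A u - y) < d"
proof -
  define R where "R = range (blinfun_apply A)"
  define F where "F n = closure (blinfun_apply A ` cball 0 (real n))" for n
  have F_sub: "F n \<subseteq> R" for n
    unfolding F_def R_def by (rule closure_minimal) (use closed in auto)
  have R_sub: "R \<subseteq> \<Union>(range F)"
  proof
    fix y
    assume "y \<in> R"
    then obtain v where v: "y = blinfun_apply A v" by (auto simp: R_def)
    obtain n :: nat where "norm v \<le> real n" using real_arch_simple by blast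
    with v have "y \<in> F n"
      unfolding F_def by (intro subsetD[OF closure_subset]) auto
    then show "y \<in> \<Union>(range F)" by blast
  qed
  have "\<exists>n. top_of_set R interior_of F n \<noteq> {}"
  proof (rule ccontr)
    assume "\<not> ?thesis"
    then have no_interior: "top_of_set R interior_of F n = {}" for n by blast
    have "closed (F n)" for n by (simp add: F_def)
    then have closedin_F: "closedin (top_of_set R) (F n)" for n
      by (rule closed_subset[OF F_sub])
    have "completely_metrizable_space (top_of_set R)"
      using closed
      by (auto simp: R_def intro: completely_metrizable_space_closedin
          completely_metrizable_space_euclidean)
    then have "top_of_set R interior_of \<Union>(range F) = {}"
      using no_interior closedin_F by (intro Baire_category_alt disjI1) auto
    moreover have "\<Union>(range F) = topspace (top_of_set R)"
      using R_sub F_sub by auto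
    ultimately have "R = {}"
      by (metis interior_of_topspace topspace_euclidean_subtopology)
    then show False by (simp add: R_def)
  qed
  then obtain n y0 T where T: "openin (top_of_set R) T" "y0 \<in> T" "T \<subseteq> F n"
    by (auto simp: interior_of_def)
  then obtain e where e: "0 < e" "ball y0 e \<inter> R \<subseteq> T"
    by (auto simp: openin_contains_ball)
  have y0: "y0 \<in> R" using T F_sub by blast
  show thesis
  proof (rule that[of e "2 * real n"])
    show "0 < e" "0 \<le> 2 * real n" using e by auto
    fix y and d :: real
    assume y: "y \<in> range (blinfun_apply A)" "norm y < e" and d: "0 < d"
    have approx: "\<exists>u. norm u \<le> real n \<and> norm (blinfun_apply A u - y') < d / 2"
      if "y' \<in> F n" for y'
    proof -
      have "0 < d / 2" using d by simp
      with that obtain a where "a \<in> blinfun_apply A ` cball 0 (real n)" "dist a y' < d / 2"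
        unfolding F_def closure_approachable by blast
      then show ?thesis by (auto simp: dist_norm)
    qed
    have "y0 + y \<in> R"
      using y0 y(1) by (auto simp: R_def blinfun.add_right[symmetric])
    moreover have "y0 + y \<in> ball y0 e"
      using y(2) by (simp add: dist_norm)
    ultimately have "y0 + y \<in> F n"
      using e(2) T(3) by blast
    then obtain u where u: "norm u \<le> real n" "norm (blinfun_apply A u - (y0 + y)) < d / 2"
      using approx by blast
    from T have "y0 \<in> F n" by blast
    then obtain v where v: "norm v \<le> real n" "norm (blinfun_apply A v - y0) < d / 2"
      using approx by blast
    have "norm (u - v) \<le> 2 * real n"
      using norm_triangle_ineq4[of u v] u(1) v(1) by simp
    moreover have "norm (blinfun_apply A (u - v) - y) < d"
      using norm_triangle_ineq4[of "blinfun_apply A u - (y0 + y)" "blinfun_apply A v - y0"] u(2) v(2)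
      by (simp add: blinfun.diff_right algebra_simps)
    ultimately show "\<exists>u. norm u \<le> 2 * real n \<and> norm (blinfun_apply A u - y) < d"
      by blast
  qed
qed

text \<open>By homogeneity, the error can be made half the norm of the target, at proportional cost.\<close>

lemma approximate_preimages:
  fixes A :: "'a::real_normed_vector \<Rightarrow>\<^sub>L 'b::banach"
  assumes closed: "closed (range (blinfun_apply A))"
  obtains M where "0 \<le> M"
    "\<And>y. y \<in> range (blinfun_apply A) \<Longrightarrow>
      \<exists>u. norm u \<le> M * norm y \<and> norm (y - blinfun_apply A u) \<le> norm y / 2"
proof -
  obtain e M where e: "0 < e" and M: "0 \<le> M"
    and approx: "\<And>y d. y \<in> range (blinfun_apply A) \<Longrightarrow> norm y < e \<Longrightarrow> 0 < d \<Longrightarrow>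
      \<exists>u. norm u \<le> M \<and> norm (blinfun_apply A u - y) < d"
    using approximate_preimages_near_zero[OF closed] by metis
  show thesis
  proof (rule that[of "2 * M / e"])
    show "0 \<le> 2 * M / e" using e M by simp
    fix y
    assume y: "y \<in> range (blinfun_apply A)"
    show "\<exists>u. norm u \<le> 2 * M / e * norm y \<and> norm (y - blinfun_apply A u) \<le> norm y / 2"
    proof (cases "y = 0")
      case True
      then show ?thesis by (intro exI[of _ 0]) simp
    next
      case False
      \<comment> \<open>Rescale \<open>y\<close> to norm \<open>e / 2\<close>.\<close>
      define t where "t = e / (2 * norm y)"
      have t: "0 < t" using e False by (simp add: t_def)
      have "t *\<^sub>R y \<in> range (blinfun_apply A)"
        using y by (auto simp: blinfun.scaleR_right[symmetric])
      moreover have "norm (t *\<^sub>R y) < e"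
        using e False by (simp add: t_def)
      ultimately obtain u
        where u: "norm u \<le> M" "norm (blinfun_apply A u - t *\<^sub>R y) < e / 4"
        using approx[of "t *\<^sub>R y" "e / 4"] e by auto
      define v where "v = (1 / t) *\<^sub>R u"
      have "norm v \<le> M / t"
        using u(1) t by (simp add: v_def divide_right_mono)
      also have "M / t = 2 * M / e * norm y"
        by (simp add: t_def)
      finally have "norm v \<le> 2 * M / e * norm y" .
      moreover have "norm (y - blinfun_apply A v) \<le> norm y / 2"
      proof -
        have "y - blinfun_apply A v = - ((1 / t) *\<^sub>R (blinfun_apply A u - t *\<^sub>R y))"
          using t by (simp add: v_def blinfun.scaleR_right algebra_simps)
        then have "norm (y - blinfun_apply A v) = norm (blinfun_apply A u - t *\<^sub>R y) / t"
          using t by simp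
        also have "\<dots> \<le> (e / 4) / t"
          using u(2) t by (intro divide_right_mono) auto
        also have "\<dots> = norm y / 2"
          using e by (simp add: t_def)
        finally show ?thesis .
      qed
      ultimately show ?thesis by blast
    qed
  qed
qed

text \<open>
  The open mapping theorem, stated for an operator with closed range. Correcting the residual of
  each approximation by the next one gives a series of preimages dominated by a geometric one;
  completeness of the domain provides its sum.
\<close>

lemma bounded_preimages:
  fixes A :: "'a::banach \<Rightarrow>\<^sub>L 'b::banach"
  assumes closed: "closed (range (blinfun_apply A))"
  obtains C where
    "\<And>y. y \<in> range (blinfun_apply A) \<Longrightarrow> \<exists>u. blinfun_apply A u = y \<and> norm u \<le> C * norm y"
proof -
  obtain M where M: "0 \<le> M"
    and ex: "\<And>y. y \<in> range (blinfun_apply A) \<Longrightarrow>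
      \<exists>u. norm u \<le> M * norm y \<and> norm (y - blinfun_apply A u) \<le> norm y / 2"
    using approximate_preimages[OF closed] by metis
  then obtain g where g: "\<And>y. y \<in> range (blinfun_apply A) \<Longrightarrow>
      norm (g y) \<le> M * norm y \<and> norm (y - blinfun_apply A (g y)) \<le> norm y / 2"
    by metis
  show thesis
  proof (rule that[of "2 * M"])
    fix y
    assume y: "y \<in> range (blinfun_apply A)"
    \<comment> \<open>\<open>r n\<close> is the residual after \<open>n\<close> steps of approximation.\<close>
    define r where "r n = ((\<lambda>s. s - blinfun_apply A (g s)) ^^ n) y" for n
    have r_Suc: "r (Suc n) = r n - blinfun_apply A (g (r n))" for n
      by (simp add: r_def)
    have r_range: "r n \<in> range (blinfun_apply A)" for n
    proof (induction n)
      case 0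
      then show ?case using y by (simp add: r_def)
    next
      case (Suc n)
      then show ?case
        unfolding r_Suc by (auto simp: blinfun.diff_right[symmetric])
    qed
    have r_le: "norm (r n) \<le> norm y * (1 / 2) ^ n" for n
    proof (induction n)
      case 0
      then show ?case by (simp add: r_def)
    next
      case (Suc n)
      have "norm (r (Suc n)) \<le> norm (r n) / 2"
        using g[OF r_range[of n]] by (simp add: r_Suc)
      with Suc show ?case by simp
    qed
    have g_le: "norm (g (r n)) \<le> M * norm y * (1 / 2) ^ n" for n
      using g[OF r_range[of n]] mult_left_mono[OF r_le[of n] M] by (simp add: mult.assoc)
    have geo: "(\<lambda>n. M * norm y * (1 / 2) ^ n) sums (M * norm y * 2)"
      using sums_mult[OF geometric_sums[of "1 / 2 :: real"], of "M * norm y"] by simp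
    have summ: "summable (\<lambda>n. norm (g (r n)))"
      by (rule summable_comparison_test'[OF sums_summable[OF geo]]) (use g_le in simp)
    define u where "u = (\<Sum>n. g (r n))"
    have "norm u \<le> (\<Sum>n. norm (g (r n)))"
      unfolding u_def by (rule summable_norm[OF summ])
    also have "\<dots> \<le> M * norm y * 2"
      using suminf_le[OF g_le summ sums_summable[OF geo]] sums_unique[OF geo] by simp
    finally have "norm u \<le> 2 * M * norm y" by simp
    moreover have "blinfun_apply A u = y"
    proof (rule sums_unique2)
      show "(\<lambda>n. blinfun_apply A (g (r n))) sums blinfun_apply A u"
        unfolding u_def
        by (intro bounded_linear.sums[OF blinfun.bounded_linear_right] summable_sums
              summable_norm_cancel[OF summ])
      have "r \<longlonglongrightarrow> 0"
      proof (rule Lim_null_comparison)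
        show "\<forall>\<^sub>F n in sequentially. norm (r n) \<le> norm y * (1 / 2) ^ n"
          using r_le by simp
        have "(\<lambda>n. norm y * (1 / 2) ^ n) \<longlonglongrightarrow> norm y * 0"
          by (intro tendsto_intros LIMSEQ_power_zero) simp
        then show "(\<lambda>n. norm y * (1 / 2) ^ n) \<longlonglongrightarrow> 0" by simp
      qed
      from telescope_sums'[OF this] show "(\<lambda>n. blinfun_apply A (g (r n))) sums y"
        by (simp add: r_Suc) (simp add: r_def)
    qed
    ultimately show "\<exists>u. blinfun_apply A u = y \<and> norm u \<le> 2 * M * norm y"
      by blast
  qed
qed

section \<open>Weak convergence with norm convergent images\<close>

theorem corollary3p13:
  fixes A :: "'a::banach \<Rightarrow>\<^sub>L 'b::banach"
    and x :: 'a and xs :: "nat \<Rightarrow> 'a"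
  assumes closed_range: "closed (range (blinfun_apply A))"
    and fin_ker: "finite_dimensional (blinfun_kernel A)"
    and weak: "weakly_converges xs x"
    and image: "(\<lambda>k. blinfun_apply A (xs k)) \<longlonglongrightarrow> blinfun_apply A x"
  shows "xs \<longlonglongrightarrow> x"
proof -
  obtain C where C:
    "\<And>y. y \<in> range (blinfun_apply A) \<Longrightarrow> \<exists>u. blinfun_apply A u = y \<and> norm u \<le> C * norm y"
    using bounded_preimages[OF closed_range] by metis
  then have "\<exists>u. blinfun_apply A u = blinfun_apply A (xs k - x) \<and>
      norm u \<le> C * norm (blinfun_apply A (xs k - x))" for k
    by blast
  then obtain u where Au: "\<And>k. blinfun_apply A (u k) = blinfun_apply A (xs k - x)"
    and u_le: "\<And>k. norm (u k) \<le> C * norm (blinfun_apply A (xs k - x))"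
    by metis
  have u: "u \<longlonglongrightarrow> 0"
  proof (rule Lim_null_comparison)
    show "\<forall>\<^sub>F k in sequentially. norm (u k) \<le> C * norm (blinfun_apply A (xs k - x))"
      using u_le by simp
    have "(\<lambda>k. C * norm (blinfun_apply A (xs k) - blinfun_apply A x))
        \<longlonglongrightarrow> C * norm (blinfun_apply A x - blinfun_apply A x)"
      by (intro tendsto_intros image)
    then show "(\<lambda>k. C * norm (blinfun_apply A (xs k - x))) \<longlonglongrightarrow> 0"
      by (simp add: blinfun.diff_right)
  qed
  define z where "z k = xs k - x - u k" for k
  obtain B where B: "finite B" "span B = blinfun_kernel A"
    using fin_ker by (auto simp: finite_dimensional_def)
  have "z \<longlonglongrightarrow> 0"
  proof (rule weakly_null_in_finite_span[OF B(1)])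
    show "z k \<in> span B" for k
      using Au[of k] by (simp add: B(2) blinfun_kernel_def z_def blinfun.diff_right)
    show "weakly_converges z 0"
      unfolding weakly_converges_def
    proof
      fix f :: "'a \<Rightarrow>\<^sub>L real"
      have fx: "(\<lambda>k. blinfun_apply f (xs k)) \<longlonglongrightarrow> blinfun_apply f x"
        using weak by (simp add: weakly_converges_def)
      have "(\<lambda>k. blinfun_apply f (xs k) - blinfun_apply f x - blinfun_apply f (u k))
          \<longlonglongrightarrow> blinfun_apply f x - blinfun_apply f x - blinfun_apply f 0"
        by (intro tendsto_diff tendsto_const fx blinfun.tendsto[OF tendsto_const u])
      then show "(\<lambda>k. blinfun_apply f (z k)) \<longlonglongrightarrow> blinfun_apply f 0"
        by (simp add: z_def blinfun.diff_right)
    qed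
  qed
  then have "(\<lambda>k. z k + u k + x) \<longlonglongrightarrow> 0 + 0 + x"
    by (intro tendsto_intros u)
  then show ?thesis by (simp add: z_def)
qed

end
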